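(* Let $G$ be a second countable Lie group. If $G$ is not metabelian, then $G$ is natural (as an abstract group).
   Context: A group $G$ is metabelian if its second derived subgroup $G'' = [G',G']$ is trivial, where $G' = [G,G]$ is the subgroup generated by all commutators. A group $(G,* )$ is called natural if there exists a metric $d$ on the set $G$ such that (i) all right translations $x \mapsto x*a$ ($a \in G$) are isometries of $(G,d)$, and (ii) every group structure $(G,\circ)$ on the same set $G$ for which all right translations $x \mapsto x \circ a$ are isometries of $(G,d)$ is isomorphic as a group to $(G,* )$. Lie groups are finite-dimensional; they are not assumed connected. *)

theory Defs
  imports "HOL-Analysis.Analysis" "HOL-Algebra.Generated_Groups"
begin

subsection \<open>Smooth maps between open subsets of Euclidean spaces\<close>

text \<open>
  The type \<^typ>\<open>nat \<Rightarrow> real\<close> with \<^const>\<open>Euclidean_space\<close> is used instead of the class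
  \<^class>\<open>euclidean_space\<close> so that dimension 0 (discrete Lie groups) is covered. The points of
  \<^term>\<open>Euclidean_space n\<close> are the sequences that vanish from index \<^term>\<open>n\<close> on.
\<close>

definition partial_deriv :: "nat \<Rightarrow> ((nat \<Rightarrow> real) \<Rightarrow> real) \<Rightarrow> (nat \<Rightarrow> real) \<Rightarrow> real" where
  "partial_deriv i f x = deriv (\<lambda>t. f (x(i := t))) (x i)"

primrec C_k_on :: "nat \<Rightarrow> nat \<Rightarrow> (nat \<Rightarrow> real) set \<Rightarrow> ((nat \<Rightarrow> real) \<Rightarrow> real) \<Rightarrow> bool" where
  "C_k_on n 0 U f \<longleftrightarrow> continuous_map (subtopology (Euclidean_space n) U) euclideanreal f"
| "C_k_on n (Suc k) U f \<longleftrightarrow>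
     continuous_map (subtopology (Euclidean_space n) U) euclideanreal f \<and>
     (\<forall>i<n. (\<forall>x\<in>U. (\<lambda>t. f (x(i := t))) differentiable (at (x i))) \<and>
            C_k_on n k U (partial_deriv i f))"

definition smooth_on :: "nat \<Rightarrow> nat \<Rightarrow> (nat \<Rightarrow> real) set \<Rightarrow> ((nat \<Rightarrow> real) \<Rightarrow> nat \<Rightarrow> real) \<Rightarrow> bool" where
  "smooth_on n m U f \<longleftrightarrow>
     openin (Euclidean_space n) U \<and> (\<forall>j<m. \<forall>k. C_k_on n k U (\<lambda>x. f x j))"


subsection \<open>Smooth manifolds\<close>

type_synonym 'a chart = "'a set \<times> ('a \<Rightarrow> nat \<Rightarrow> real)"

definition is_chart :: "nat \<Rightarrow> 'a topology \<Rightarrow> 'a chart \<Rightarrow> bool" where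
  "is_chart n X = (\<lambda>(U, \<phi>). openin X U \<and> openin (Euclidean_space n) (\<phi> ` U) \<and>
     homeomorphic_map (subtopology X U) (subtopology (Euclidean_space n) (\<phi> ` U)) \<phi>)"

text \<open>
  Second countability is not part of this notion; it is a separate hypothesis where it is needed.
\<close>

definition smooth_manifold :: "nat \<Rightarrow> 'a topology \<Rightarrow> 'a chart set \<Rightarrow> bool" where
  "smooth_manifold n X \<A> \<longleftrightarrow>
     Hausdorff_space X \<and>
     (\<forall>c\<in>\<A>. is_chart n X c) \<and>
     (\<Union>(U, \<phi>)\<in>\<A>. U) = topspace X \<and>
     (\<forall>(U, \<phi>)\<in>\<A>. \<forall>(V, \<psi>)\<in>\<A>. smooth_on n n (\<phi> ` (U \<inter> V)) (\<psi> \<circ> inv_into U \<phi>))"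

definition smooth_map ::
  "nat \<Rightarrow> 'a topology \<Rightarrow> 'a chart set \<Rightarrow> nat \<Rightarrow> 'b topology \<Rightarrow> 'b chart set \<Rightarrow> ('a \<Rightarrow> 'b) \<Rightarrow> bool" where
  "smooth_map n X \<A> m Y \<B> f \<longleftrightarrow>
     continuous_map X Y f \<and>
     (\<forall>(U, \<phi>)\<in>\<A>. \<forall>(V, \<psi>)\<in>\<B>. smooth_on n m (\<phi> ` (U \<inter> f -` V)) (\<psi> \<circ> f \<circ> inv_into U \<phi>))"

text \<open>
  The identification of pairs of points of n-space and m-space with points of (n+m)-space
  concatenates the first \<^term>\<open>n\<close> coordinates of \<^term>\<open>u\<close> with the coordinates of \<^term>\<open>v\<close>.
\<close>

definition join_coords :: "nat \<Rightarrow> (nat \<Rightarrow> real) \<Rightarrow> (nat \<Rightarrow> real) \<Rightarrow> nat \<Rightarrow> real" where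
  "join_coords n u v = (\<lambda>i. if i < n then u i else v (i - n))"

definition prod_atlas :: "nat \<Rightarrow> 'a chart set \<Rightarrow> 'b chart set \<Rightarrow> ('a \<times> 'b) chart set" where
  "prod_atlas n \<A> \<B> =
     {(U \<times> V, \<lambda>(x, y). join_coords n (\<phi> x) (\<psi> y)) | U \<phi> V \<psi>. (U, \<phi>) \<in> \<A> \<and> (V, \<psi>) \<in> \<B>}"


subsection \<open>Lie groups\<close>

text \<open>
  By homogeneity all components of a Lie group have the same dimension, so one \<^term>\<open>n\<close>
  suffices; connectedness is not assumed.
\<close>

definition lie_group :: "('a, 'b) monoid_scheme \<Rightarrow> nat \<Rightarrow> 'a topology \<Rightarrow> 'a chart set \<Rightarrow> bool" where
  "lie_group G n X \<A> \<longleftrightarrow>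
     group G \<and> topspace X = carrier G \<and> smooth_manifold n X \<A> \<and>
     smooth_map (n + n) (prod_topology X X) (prod_atlas n \<A> \<A>) n X \<A> (\<lambda>(x, y). x \<otimes>\<^bsub>G\<^esub> y) \<and>
     smooth_map n X \<A> n X \<A> (\<lambda>x. inv\<^bsub>G\<^esub> x)"


subsection \<open>Metabelian and natural groups\<close>

definition metabelian :: "('a, 'b) monoid_scheme \<Rightarrow> bool" where
  "metabelian G \<longleftrightarrow> group G \<and> derived G (derived G (carrier G)) = {\<one>\<^bsub>G\<^esub>}"

definition isometry_of :: "'a set \<Rightarrow> ('a \<Rightarrow> 'a \<Rightarrow> real) \<Rightarrow> ('a \<Rightarrow> 'a) \<Rightarrow> bool" where
  "isometry_of M d f \<longleftrightarrow> bij_betw f M M \<and> (\<forall>x\<in>M. \<forall>y\<in>M. d (f x) (f y) = d x y)"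

definition isometric_right_translations ::
  "('a, 'b) monoid_scheme \<Rightarrow> ('a \<Rightarrow> 'a \<Rightarrow> real) \<Rightarrow> bool" where
  "isometric_right_translations G d \<longleftrightarrow>
     (\<forall>a\<in>carrier G. isometry_of (carrier G) d (\<lambda>x. x \<otimes>\<^bsub>G\<^esub> a))"

definition natural_group :: "('a, 'b) monoid_scheme \<Rightarrow> bool" where
  "natural_group G \<longleftrightarrow> group G \<and>
     (\<exists>d. Metric_space (carrier G) d \<and> isometric_right_translations G d \<and>
          (\<forall>H :: 'a monoid. group H \<and> carrier H = carrier G \<and> isometric_right_translations H d
             \<longrightarrow> H \<cong> G))"

end

theory Submission
  imports Defs
begin

text \<open>
  A second countable Hausdorff space has at most continuum many points, so it is enough to show
  that every non-metabelian group \<open>G\<close> of at most that size is natural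
  (\<open>nonmetabelian_imp_natural\<close>). On such a group there is a right-invariant metric
  \<open>d(x, y) = w(x y\<^sup>-\<^sup>1)\<close> whose weight \<open>w\<close> separates any two elements that are not inverse to
  each other. Values between 1 and 2 make the triangle inequality automatic, so \<open>w\<close> can be any
  injection into that interval, symmetrised.

  An isometry \<open>\<phi>\<close> of this metric satisfies \<open>\<phi>(x) \<phi>(y)\<^sup>-\<^sup>1 = (x y\<^sup>-\<^sup>1)\<^sup>\<plusminus>\<^sup>1\<close> for all \<open>x\<close> and \<open>y\<close>.
  The core of the proof (\<open>metabelian_if_nontrivial_quotient_map\<close>) is that a map of this kind
  that fixes the identity element is trivial unless \<open>G\<close> is metabelian. Such a \<open>\<phi>\<close> sends each
  element to itself or to its inverse. Let \<open>A\<close> be the set of its fixed points and \<open>B\<close> the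
  complement. Comparing \<open>a \<in> A\<close> with \<open>b \<in> B\<close> shows that \<open>b\<close> inverts \<open>a\<close> by conjugation, and
  comparing two elements of \<open>B\<close> shows that they commute or have the same square. Suppose that
  \<open>B\<close> is not empty. If some \<open>a \<in> A\<close> has \<open>a\<^sup>2 \<noteq> 1\<close>, then every element of \<open>G\<close> centralises or
  inverts \<open>a\<close>, and the centraliser of \<open>a\<close> is inverted by an element of \<open>B\<close>, hence abelian; it
  contains all commutators. Otherwise any two elements of \<open>G\<close> commute or have the same square,
  and this makes all commutators central.

  So in a non-metabelian \<open>G\<close> the isometries are exactly the right translations. If \<open>H\<close> is another
  group structure whose right translations are isometries, then \<open>x \<circ> h = x * (1 \<circ> h)\<close> with \<open>1\<close>
  the identity element of \<open>G\<close>, and \<open>h \<mapsto> 1 \<circ> h\<close> is an isomorphism from \<open>H\<close> to \<open>G\<close>.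
\<close>

section \<open>Conjugation equations\<close>

text \<open>
  That \<open>x\<close> conjugates \<open>u\<close> to \<open>v\<close> is written \<open>u \<otimes> x = x \<otimes> v\<close>. With \<open>v = u\<close> this is commutation,
  with \<open>v = inv u\<close> it says that \<open>x\<close> inverts \<open>u\<close>.
\<close>

lemma (in group) intertwine_inv:
  assumes "x \<in> carrier G" "u \<in> carrier G" "v \<in> carrier G" "u \<otimes> x = x \<otimes> v"
  shows "inv u \<otimes> x = x \<otimes> inv v"
proof -
  have "inv u \<otimes> x = inv u \<otimes> (x \<otimes> v) \<otimes> inv v" using assms(1-3) by (simp add: m_assoc)
  also have "\<dots> = inv u \<otimes> (u \<otimes> x) \<otimes> inv v" using assms(4) by simp
  also have "\<dots> = x \<otimes> inv v" using assms(1-3) by (simp flip: m_assoc)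
  finally show ?thesis .
qed

lemma (in group) intertwine_inv_conjugator:
  assumes "x \<in> carrier G" "u \<in> carrier G" "v \<in> carrier G" "u \<otimes> x = x \<otimes> v"
  shows "v \<otimes> inv x = inv x \<otimes> u"
proof -
  have "v \<otimes> inv x = inv x \<otimes> (x \<otimes> v) \<otimes> inv x" using assms(1-3) by (simp flip: m_assoc)
  also have "\<dots> = inv x \<otimes> (u \<otimes> x) \<otimes> inv x" using assms(4) by simp
  also have "\<dots> = inv x \<otimes> u" using assms(1-3) by (simp add: m_assoc)
  finally show ?thesis .
qed

lemma (in group) intertwine_mult:
  assumes "x \<in> carrier G" "y \<in> carrier G" "u \<in> carrier G" "v \<in> carrier G" "w \<in> carrier G"
    and "u \<otimes> x = x \<otimes> v" "v \<otimes> y = y \<otimes> w"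
  shows "u \<otimes> (x \<otimes> y) = x \<otimes> y \<otimes> w"
proof -
  have "u \<otimes> (x \<otimes> y) = x \<otimes> (v \<otimes> y)" using assms(1-6) by (simp flip: m_assoc)
  also have "\<dots> = x \<otimes> y \<otimes> w" using assms(1-5,7) by (simp add: m_assoc)
  finally show ?thesis .
qed

section \<open>Two criteria for being metabelian\<close>

lemma (in group) centralizer_subgroup:
  assumes "S \<subseteq> carrier G"
  shows "subgroup {x \<in> carrier G. \<forall>s\<in>S. x \<otimes> s = s \<otimes> x} G"
proof (rule subgroupI)
  fix x y
  assume xy: "x \<in> {x \<in> carrier G. \<forall>s\<in>S. x \<otimes> s = s \<otimes> x}"
    "y \<in> {x \<in> carrier G. \<forall>s\<in>S. x \<otimes> s = s \<otimes> x}"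
  have "x \<otimes> y \<otimes> s = s \<otimes> (x \<otimes> y)" if "s \<in> S" for s
    using intertwine_mult[of x y s s s] assms that xy by (auto simp: subset_iff)
  then show "x \<otimes> y \<in> {x \<in> carrier G. \<forall>s\<in>S. x \<otimes> s = s \<otimes> x}" using xy by auto
next
  fix x
  assume x: "x \<in> {x \<in> carrier G. \<forall>s\<in>S. x \<otimes> s = s \<otimes> x}"
  have "inv x \<otimes> s = s \<otimes> inv x" if "s \<in> S" for s
    using intertwine_inv[of s x x] assms that x by (auto simp: subset_iff)
  then show "inv x \<in> {x \<in> carrier G. \<forall>s\<in>S. x \<otimes> s = s \<otimes> x}" using x by auto
next
  have "\<one> \<in> {x \<in> carrier G. \<forall>s\<in>S. x \<otimes> s = s \<otimes> x}" using assms by auto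
  then show "{x \<in> carrier G. \<forall>s\<in>S. x \<otimes> s = s \<otimes> x} \<noteq> {}" by blast
qed auto

lemma (in group) metabelianI:
  assumes K: "subgroup K G"
    and comm: "\<And>x y. \<lbrakk>x \<in> K; y \<in> K\<rbrakk> \<Longrightarrow> x \<otimes> y = y \<otimes> x"
    and commutators: "\<And>x y. \<lbrakk>x \<in> carrier G; y \<in> carrier G\<rbrakk> \<Longrightarrow> x \<otimes> y \<otimes> inv x \<otimes> inv y \<in> K"
  shows "metabelian G"
proof -
  have "derived_set G (carrier G) \<subseteq> K" using commutators by auto
  then have sub: "derived G (carrier G) \<subseteq> K"
    unfolding derived_def using generate_subgroup_incl K by blast
  have "x \<otimes> y \<otimes> inv x \<otimes> inv y = \<one>"
    if "x \<in> derived G (carrier G)" "y \<in> derived G (carrier G)" for x y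
  proof -
    have xy: "x \<in> carrier G" "y \<in> carrier G" "x \<in> K" "y \<in> K"
      using that sub subgroup.subset[OF K] by auto
    then show ?thesis using comm[of x y] by (simp add: m_assoc)
  qed
  then have "derived_set G (derived G (carrier G)) \<subseteq> {\<one>}" by auto
  then have "derived G (derived G (carrier G)) \<subseteq> {\<one>}"
    unfolding derived_def[of G "derived G (carrier G)"]
    using generate_subgroup_incl triv_subgroup by blast
  moreover have "\<one> \<in> derived G (derived G (carrier G))"
    by (simp add: derived_def generate.one)
  ultimately show ?thesis by (auto simp: metabelian_def is_group)
qed

text \<open>
  The action on \<open>a\<close> by conjugation is a homomorphism to a group with at most two elements, which
  is abelian. So commutators act trivially and lie in the centraliser of \<open>a\<close>.
\<close>

lemma (in group) metabelian_if_centralizer_abelian: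
  assumes a: "a \<in> carrier G"
    and comm: "\<And>x y. \<lbrakk>x \<in> carrier G; y \<in> carrier G; x \<otimes> a = a \<otimes> x; y \<otimes> a = a \<otimes> y\<rbrakk>
      \<Longrightarrow> x \<otimes> y = y \<otimes> x"
    and act: "\<And>x. x \<in> carrier G \<Longrightarrow> a \<otimes> x = x \<otimes> a \<or> a \<otimes> x = x \<otimes> inv a"
  shows "metabelian G"
proof (rule metabelianI)
  show "subgroup {x \<in> carrier G. \<forall>s\<in>{a}. x \<otimes> s = s \<otimes> x} G"
    by (rule centralizer_subgroup) (use a in auto)
next
  fix x y assume xy: "x \<in> carrier G" "y \<in> carrier G"
  have inv_act: "inv a \<otimes> z = z \<otimes> a" if "z \<in> carrier G" "a \<otimes> z = z \<otimes> inv a" for z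
    using intertwine_inv[of z a "inv a"] that a by simp
  have inv_comm: "inv a \<otimes> z = z \<otimes> inv a" if "z \<in> carrier G" "a \<otimes> z = z \<otimes> a" for z
    using intertwine_inv[of z a a] that a by simp
  note prod = intertwine_mult[where u = a]
  \<comment> \<open>Both products act on \<open>a\<close> with the product of the two signs.\<close>
  have "\<exists>a'\<in>carrier G. a \<otimes> (x \<otimes> y) = x \<otimes> y \<otimes> a' \<and> a \<otimes> (y \<otimes> x) = y \<otimes> x \<otimes> a'"
  proof (cases "a \<otimes> x = x \<otimes> a"; cases "a \<otimes> y = y \<otimes> a")
    assume "a \<otimes> x = x \<otimes> a" "a \<otimes> y = y \<otimes> a"
    then show ?thesis using prod[of x y a a] prod[of y x a a] xy a inv_closed[OF a] by blast
  next
    assume *: "a \<otimes> x = x \<otimes> a" "a \<otimes> y \<noteq> y \<otimes> a"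
    then have "a \<otimes> y = y \<otimes> inv a" using act xy by blast
    then show ?thesis
      using * prod[of x y a "inv a"] prod[of y x "inv a" "inv a"] inv_comm[of x] xy a inv_closed[OF a] by blast
  next
    assume *: "a \<otimes> x \<noteq> x \<otimes> a" "a \<otimes> y = y \<otimes> a"
    then have "a \<otimes> x = x \<otimes> inv a" using act xy by blast
    then show ?thesis
      using * prod[of y x a "inv a"] prod[of x y "inv a" "inv a"] inv_comm[of y] xy a inv_closed[OF a] by blast
  next
    assume "a \<otimes> x \<noteq> x \<otimes> a" "a \<otimes> y \<noteq> y \<otimes> a"
    then have "a \<otimes> x = x \<otimes> inv a" "a \<otimes> y = y \<otimes> inv a" using act xy by blast+
    then show ?thesis
      using prod[of y x "inv a" a] prod[of x y "inv a" a] inv_act[of x] inv_act[of y] xy a inv_closed[OF a] by blast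
  qed
  then obtain a' where a': "a' \<in> carrier G" "a \<otimes> (x \<otimes> y) = x \<otimes> y \<otimes> a'"
      "a \<otimes> (y \<otimes> x) = y \<otimes> x \<otimes> a'" by blast
  have "a' \<otimes> inv (y \<otimes> x) = inv (y \<otimes> x) \<otimes> a"
    using intertwine_inv_conjugator[of "y \<otimes> x" a a'] a' a xy by simp
  then have "x \<otimes> y \<otimes> inv (y \<otimes> x) \<otimes> a = a \<otimes> (x \<otimes> y \<otimes> inv (y \<otimes> x))"
    using intertwine_mult[of "x \<otimes> y" "inv (y \<otimes> x)" a a' a] a' a xy by simp
  moreover have "x \<otimes> y \<otimes> inv (y \<otimes> x) = x \<otimes> y \<otimes> inv x \<otimes> inv y"
    using xy by (simp add: inv_mult_group m_assoc)
  ultimately show "x \<otimes> y \<otimes> inv x \<otimes> inv y \<in> {x \<in> carrier G. \<forall>s\<in>{a}. x \<otimes> s = s \<otimes> x}"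
    using xy by simp
next
  fix x y
  assume "x \<in> {x \<in> carrier G. \<forall>s\<in>{a}. x \<otimes> s = s \<otimes> x}"
    "y \<in> {x \<in> carrier G. \<forall>s\<in>{a}. x \<otimes> s = s \<otimes> x}"
  then show "x \<otimes> y = y \<otimes> x" using comm[of x y] by blast
qed

text \<open>
  If \<open>x\<close> and \<open>y\<close> do not commute, then neither do \<open>x\<close> and \<open>x y\<close>. Comparing the squares gives
  \<open>y x y = x\<close>, so the commutator of \<open>x\<close> and \<open>y\<close> is the inverse of \<open>y\<^sup>2\<close>. All squares are
  central: an element that does not commute with \<open>y\<close> has \<open>y\<^sup>2\<close> as its own square. The
  quaternion group is the typical nonabelian example.
\<close>

lemma (in group) metabelian_if_commute_or_equal_squares:
  assumes sq: "\<And>x y. \<lbrakk>x \<in> carrier G; y \<in> carrier G\<rbrakk> \<Longrightarrow> x \<otimes> y = y \<otimes> x \<or> x \<otimes> x = y \<otimes> y"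
  shows "metabelian G"
proof (rule metabelianI)
  show "subgroup {x \<in> carrier G. \<forall>s\<in>carrier G. x \<otimes> s = s \<otimes> x} G"
    by (rule centralizer_subgroup) simp
next
  fix x y assume xy: "x \<in> carrier G" "y \<in> carrier G"
  show "x \<otimes> y \<otimes> inv x \<otimes> inv y \<in> {x \<in> carrier G. \<forall>s\<in>carrier G. x \<otimes> s = s \<otimes> x}"
  proof (cases "x \<otimes> y = y \<otimes> x")
    case True
    then have "x \<otimes> y \<otimes> inv x \<otimes> inv y = \<one>" using xy by (simp add: m_assoc)
    then show ?thesis by simp
  next
    case False
    then have "x \<otimes> (x \<otimes> y) \<noteq> x \<otimes> y \<otimes> x" using xy by (simp add: m_assoc)
    then have "x \<otimes> x = x \<otimes> y \<otimes> (x \<otimes> y)" using sq[of x "x \<otimes> y"] xy by blast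
    also have "\<dots> = x \<otimes> (y \<otimes> (x \<otimes> y))" using xy by (simp add: m_assoc)
    finally have "y \<otimes> (x \<otimes> y) = x" using xy by simp
    then have "x \<otimes> y = inv y \<otimes> x" using inv_solve_left[of "x \<otimes> y" y x] xy by simp
    then have "x \<otimes> y \<otimes> inv x \<otimes> inv y = inv y \<otimes> x \<otimes> inv x \<otimes> inv y" by (rule arg_cong)
    also have "\<dots> = inv y \<otimes> (x \<otimes> inv x) \<otimes> inv y"
      using m_assoc[of "inv y" x "inv x"] xy by (simp only: inv_closed)
    also have "\<dots> = inv (y \<otimes> y)" using xy by (simp add: inv_mult_group)
    finally have eq: "x \<otimes> y \<otimes> inv x \<otimes> inv y = inv (y \<otimes> y)" .
    have "y \<otimes> y \<otimes> g = g \<otimes> (y \<otimes> y)" if "g \<in> carrier G" for g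
      using sq[OF that xy(2)]
    proof
      assume "g \<otimes> y = y \<otimes> g"
      then show ?thesis using intertwine_mult[of y y g g g] that xy by simp
    next
      assume *: "g \<otimes> g = y \<otimes> y"
      show ?thesis unfolding *[symmetric] using that by (simp add: m_assoc)
    qed
    then have "y \<otimes> y \<in> {x \<in> carrier G. \<forall>s\<in>carrier G. x \<otimes> s = s \<otimes> x}" using xy by simp
    then show ?thesis
      unfolding eq by (rule subgroup.m_inv_closed[OF centralizer_subgroup[OF order_refl]])
  qed
qed blast

section \<open>Maps that preserve quotients up to inversion\<close>

text \<open>
  The groups with such a map \<open>\<phi>\<close> include every abelian group of exponent greater than 2, by
  inversion, and groups with an abelian subgroup of index 2 such that all elements outside it have
  order 4 and invert it, by the map that inverts exactly the elements outside.
\<close>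

lemma (in group) metabelian_if_nontrivial_quotient_map:
  assumes closed: "\<And>x. x \<in> carrier G \<Longrightarrow> \<phi> x \<in> carrier G"
    and one: "\<phi> \<one> = \<one>"
    and quot: "\<And>x y. \<lbrakk>x \<in> carrier G; y \<in> carrier G\<rbrakk>
      \<Longrightarrow> \<phi> x \<otimes> inv (\<phi> y) = x \<otimes> inv y \<or> \<phi> x \<otimes> inv (\<phi> y) = inv (x \<otimes> inv y)"
    and b: "b \<in> carrier G" "\<phi> b \<noteq> b"
  shows "metabelian G"
proof -
  define A where "A = {x \<in> carrier G. \<phi> x = x}"
  define B where "B = {x \<in> carrier G. \<phi> x \<noteq> x}"
  have AB: "x \<in> A \<or> x \<in> B" if "x \<in> carrier G" for x using that by (auto simp: A_def B_def)
  have carr: "\<And>x. x \<in> A \<Longrightarrow> x \<in> carrier G" "\<And>x. x \<in> B \<Longrightarrow> x \<in> carrier G"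
    by (auto simp: A_def B_def)
  have B_inv: "\<phi> x = inv x" "x \<noteq> inv x" if "x \<in> B" for x
    using quot[of x \<one>] that closed[of x] by (auto simp: B_def one)
  \<comment> \<open>The pair \<open>a\<close>, \<open>b\<close> has quotient \<open>a b\<^sup>-\<^sup>1\<close> before and \<open>a b\<close> after applying \<open>\<phi>\<close>; these
    differ as \<open>b\<close> is not its own inverse.\<close>
  have inverts: "a \<otimes> b = b \<otimes> inv a" if ab: "a \<in> A" "b \<in> B" for a b
  proof -
    have c: "a \<in> carrier G" "b \<in> carrier G" using ab carr by auto
    have "a \<otimes> b = a \<otimes> inv b \<or> a \<otimes> b = b \<otimes> inv a"
      using quot[of a b] B_inv[OF ab(2)] ab c by (auto simp: A_def inv_mult_group)
    then show ?thesis using B_inv(2)[OF ab(2)] c by simp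
  qed
  have bB: "b \<in> B" using b by (simp add: B_def)
  \<comment> \<open>Conjugation by \<open>b\<close> is a homomorphism and inversion reverses products, so the two
    factors commute whenever all three elements are inverted.\<close>
  have A_comm: "x \<otimes> y = y \<otimes> x" if A: "x \<in> A" "y \<in> A" "x \<otimes> y \<in> A" for x y
  proof -
    have c: "x \<in> carrier G" "y \<in> carrier G" using A carr by auto
    have "b \<otimes> (inv y \<otimes> inv x) = x \<otimes> y \<otimes> b"
      using inverts[OF A(3) bB] c by (simp add: inv_mult_group)
    also have "\<dots> = x \<otimes> b \<otimes> inv y" using inverts[OF A(2) bB] c b by (simp add: m_assoc)
    also have "\<dots> = b \<otimes> (inv x \<otimes> inv y)"
      unfolding inverts[OF A(1) bB] using c b by (simp add: m_assoc)
    finally have "inv (x \<otimes> y) = inv (y \<otimes> x)" using c b by (simp add: inv_mult_group)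
    then show ?thesis using c by (metis inv_inv m_closed)
  qed
  show ?thesis
  proof (cases "\<exists>a\<in>A. a \<noteq> inv a")
    case True
    then obtain a where a: "a \<in> A" "a \<noteq> inv a" by blast
    then have ac: "a \<in> carrier G" using carr by simp
    \<comment> \<open>An element of \<open>B\<close> inverts \<open>a\<close>, so it cannot centralise it too.\<close>
    have cent: "x \<in> A" if "x \<in> carrier G" "x \<otimes> a = a \<otimes> x" for x
    proof (rule ccontr)
      assume "x \<notin> A"
      then have "x \<otimes> a = x \<otimes> inv a" using inverts[OF a(1), of x] AB that by auto
      then show False using that a(2) ac by simp
    qed
    show ?thesis
    proof (rule metabelian_if_centralizer_abelian[OF ac])
      fix x y
      assume x: "x \<in> carrier G" "x \<otimes> a = a \<otimes> x" and y: "y \<in> carrier G" "y \<otimes> a = a \<otimes> y"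
      have "x \<otimes> y \<otimes> a = a \<otimes> (x \<otimes> y)" 
        using intertwine_mult[of x y a a a] x y ac by simp
      then have xy: "x \<otimes> y \<in> A" using cent x y by simp
      show "x \<otimes> y = y \<otimes> x" using A_comm cent x y xy by blast
    next
      fix x assume x: "x \<in> carrier G"
      show "a \<otimes> x = x \<otimes> a \<or> a \<otimes> x = x \<otimes> inv a"
      proof (cases "x \<in> B")
        case True
        then show ?thesis using inverts a by blast
      next
        case False
        then have xA: "x \<in> A" using AB x by blast
        \<comment> \<open>If \<open>a x\<close> inverts \<open>a\<close>, so does \<open>x\<close>.\<close>
        show ?thesis
        proof (cases "a \<otimes> x \<in> B")
          case True
          then have "a \<otimes> (a \<otimes> x) = a \<otimes> x \<otimes> inv a" using inverts a by blast
          then have "a \<otimes> (a \<otimes> x) = a \<otimes> (x \<otimes> inv a)" using x ac by (simp add: m_assoc)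
          then show ?thesis using x ac by simp
        next
          case False
          then have ax: "a \<otimes> x \<in> A" using AB x ac by blast
          then show ?thesis using A_comm a(1) xA by blast
        qed
      qed
    qed
  next
    case False
    then have A_sq: "a = inv a" if "a \<in> A" for a using that by blast
    have A_sq': "a \<otimes> a = \<one>" if "a \<in> A" for a using A_sq[OF that] carr(1)[OF that] by (metis r_inv)
    show ?thesis
    proof (rule metabelian_if_commute_or_equal_squares)
      fix x y assume xy: "x \<in> carrier G" "y \<in> carrier G"
      have BB: "x \<otimes> y = y \<otimes> x \<or> x \<otimes> x = y \<otimes> y" if "x \<in> B" "y \<in> B"
      proof -
        have "inv x \<otimes> y = x \<otimes> inv y \<or> inv x \<otimes> y = y \<otimes> inv x"
          using quot[OF xy] B_inv(1) that xy by (simp add: inv_mult_group)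
        then show ?thesis
        proof
          assume *: "inv x \<otimes> y = x \<otimes> inv y"
          have "y \<otimes> y = x \<otimes> (inv x \<otimes> y) \<otimes> y" using xy by (simp flip: m_assoc)
          also have "\<dots> = x \<otimes> x" unfolding * using xy by (simp add: m_assoc)
          finally show ?thesis by simp
        next
          assume "inv x \<otimes> y = y \<otimes> inv x"
          then show ?thesis
            using intertwine_inv[of y "inv x" "inv x"] xy by simp
        qed
      qed
      have "x \<in> A \<or> x \<in> B" "y \<in> A \<or> y \<in> B" using AB xy by auto
      then show "x \<otimes> y = y \<otimes> x \<or> x \<otimes> x = y \<otimes> y"
        using BB A_sq' A_sq inverts by metis
    qed
  qed
qed

section \<open>A metric whose isometries are the right translations\<close>

text \<open>
  The cardinality bound leaves room for a metric in which only pairs with equal or inverse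
  quotients are equidistant.
\<close>

lemma (in group) nonmetabelian_imp_natural:
  assumes small: "carrier G \<lesssim> (UNIV :: real set)"
    and nonmeta: "\<not> metabelian G"
  shows "natural_group G"
proof -
  have "(UNIV :: real set) \<approx> {1<..<2::real}"
    by (rule eqpoll_sym, rule open_interval_eqpoll_reals[THEN iffD2]) simp
  with small have "carrier G \<lesssim> {1<..<2::real}" by (rule lepoll_trans2)
  then obtain e :: "'a \<Rightarrow> real" where e: "inj_on e (carrier G)" "e ` carrier G \<subseteq> {1<..<2}"
    by (auto simp: lepoll_def)
  \<comment> \<open>The maximum symmetrises \<open>e\<close> and is still one of two values of \<open>e\<close>, so it determines
    \<open>g\<close> up to inversion.\<close>
  define w where "w g = max (e g) (e (inv g))" for g
  have w_bounds: "1 < w g" "w g < 2" if "g \<in> carrier G" for g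
    using e(2) that inv_closed[OF that] by (auto simp: w_def less_max_iff_disj image_subset_iff)
  have w_inv: "w (inv g) = w g" if "g \<in> carrier G" for g
    using that by (simp add: w_def max.commute)
  have w_eq: "g = h \<or> g = inv h" if "w g = w h" "g \<in> carrier G" "h \<in> carrier G" for g h
  proof -
    have "e g = e h \<or> e g = e (inv h) \<or> e (inv g) = e h \<or> e (inv g) = e (inv h)"
      using that(1) by (auto simp: w_def max_def split: if_splits)
    then have "g = h \<or> g = inv h \<or> inv g = h \<or> inv g = inv h"
      using inj_onD[OF e(1)] that(2,3) by (meson inv_closed)
    then show ?thesis using that by (metis inv_inv)
  qed
  \<comment> \<open>Outside the carrier the quotient is unspecified, but a metric has to be symmetric and
    nonnegative there as well, hence the value 0.\<close>
  define d where "d x y = (if x \<in> carrier G \<and> y \<in> carrier G \<and> x \<noteq> y then w (x \<otimes> inv y) else 0)" for x y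
  have metric: "Metric_space (carrier G) d"
  proof
    fix x y
    show "0 \<le> d x y" using w_bounds(1)[of "x \<otimes> inv y"] by (auto simp: d_def)
    show "d x y = d y x" using w_inv[of "x \<otimes> inv y"] by (auto simp: d_def inv_mult_group)
  next
    fix x y assume "x \<in> carrier G" "y \<in> carrier G"
    then show "d x y = 0 \<longleftrightarrow> x = y" using w_bounds(1)[of "x \<otimes> inv y"] by (auto simp: d_def)
  next
    fix x y z assume c: "x \<in> carrier G" "y \<in> carrier G" "z \<in> carrier G"
    then show "d x z \<le> d x y + d y z"
      using w_bounds[of "x \<otimes> inv z"] w_bounds(1)[of "x \<otimes> inv y"] w_bounds(1)[of "y \<otimes> inv z"]
      by (auto simp: d_def)
  qed
  have d_eq: "u \<otimes> inv v = x \<otimes> inv y \<or> u \<otimes> inv v = inv (x \<otimes> inv y)"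
    if "d u v = d x y" "u \<in> carrier G" "v \<in> carrier G" "x \<in> carrier G" "y \<in> carrier G" for u v x y
  proof (cases "x = y")
    case True
    then have "u = v" using that Metric_space.zero[OF metric] by metis
    then show ?thesis using True that by simp
  next
    case False
    then have "u \<noteq> v" using that Metric_space.zero[OF metric] by metis
    then show ?thesis using that False w_eq[of "u \<otimes> inv v" "x \<otimes> inv y"] by (simp add: d_def)
  qed
  have translation: "isometry_of (carrier G) d (\<lambda>x. x \<otimes> a)" if a: "a \<in> carrier G" for a
    unfolding isometry_of_def
  proof (intro conjI ballI)
    show "bij_betw (\<lambda>x. x \<otimes> a) (carrier G) (carrier G)"
      by (rule bij_betwI[where g = "\<lambda>x. x \<otimes> inv a"]) (use a in \<open>auto simp: m_assoc\<close>)
    fix x y assume xy: "x \<in> carrier G" "y \<in> carrier G"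
    have "a \<otimes> (inv a \<otimes> inv y) = inv y" using a xy by (simp flip: m_assoc)
    then have "x \<otimes> a \<otimes> inv (y \<otimes> a) = x \<otimes> inv y"
      using a xy by (simp add: inv_mult_group m_assoc)
    then show "d (x \<otimes> a) (y \<otimes> a) = d x y" using a xy by (simp add: d_def)
  qed
  have "H \<cong> G" if H: "group H" "carrier H = carrier G" "isometric_right_translations H d"
    for H :: "'a monoid"
  proof -
    interpret H: group H by fact
    define \<theta> where "\<theta> h = \<one> \<otimes>\<^bsub>H\<^esub> h" for h
    have \<theta>_closed: "\<theta> h \<in> carrier G" if "h \<in> carrier G" for h
      using that H.m_closed[of \<one> h] H(2) by (simp add: \<theta>_def)
    have mult: "x \<otimes>\<^bsub>H\<^esub> h = x \<otimes> \<theta> h" if x: "x \<in> carrier G" and h: "h \<in> carrier G" for x h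
    proof -
      \<comment> \<open>The right translation by \<open>h\<close> in \<open>H\<close>, corrected by one in \<open>G\<close> to fix \<open>\<one>\<close>.\<close>
      define \<phi> where "\<phi> y = (y \<otimes>\<^bsub>H\<^esub> h) \<otimes> inv (\<theta> h)" for y
      have Hc: "y \<otimes>\<^bsub>H\<^esub> h \<in> carrier G" if "y \<in> carrier G" for y
        using that h H.m_closed[of y h] H(2) by simp
      have closed: "\<phi> y \<in> carrier G" if "y \<in> carrier G" for y
        using that Hc \<theta>_closed h by (simp add: \<phi>_def)
      have "\<phi> x = x"
      proof (rule ccontr)
        assume ne: "\<phi> x \<noteq> x"
        have "metabelian G"
        proof (rule metabelian_if_nontrivial_quotient_map[of \<phi>, OF closed _ _ x ne])
          show "\<phi> \<one> = \<one>" using \<theta>_closed[OF h] by (simp add: \<phi>_def flip: \<theta>_def)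
          fix y z assume yz: "y \<in> carrier G" "z \<in> carrier G"
          have "d (\<phi> y) (\<phi> z) = d (y \<otimes>\<^bsub>H\<^esub> h) (z \<otimes>\<^bsub>H\<^esub> h)"
            using translation[of "inv (\<theta> h)"] \<theta>_closed[OF h] Hc yz
            by (simp add: isometry_of_def \<phi>_def)
          also have "\<dots> = d y z"
            using H(2,3) h yz by (simp add: isometric_right_translations_def isometry_of_def)
          finally show "\<phi> y \<otimes> inv \<phi> z = y \<otimes> inv z \<or> \<phi> y \<otimes> inv \<phi> z = inv (y \<otimes> inv z)"
            using d_eq closed yz by blast
        qed
        then show False using nonmeta by contradiction
      qed
      then show ?thesis using Hc[OF x] \<theta>_closed[OF h] x
        by (metis \<phi>_def inv_closed inv_solve_right)
    qed
    have "\<theta> \<in> hom H G"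
    proof (rule homI)
      fix x y assume "x \<in> carrier H" "y \<in> carrier H"
      then have xy: "x \<in> carrier G" "y \<in> carrier G" using H(2) by auto
      have "\<theta> (x \<otimes>\<^bsub>H\<^esub> y) = \<theta> x \<otimes>\<^bsub>H\<^esub> y"
        using H.m_assoc[of \<one> x y] H(2) xy by (simp add: \<theta>_def)
      then show "\<theta> (x \<otimes>\<^bsub>H\<^esub> y) = \<theta> x \<otimes> \<theta> y" using mult \<theta>_closed xy by simp
    qed (use \<theta>_closed H(2) in simp)
    moreover have "bij_betw \<theta> (carrier H) (carrier G)"
      by (rule bij_betwI[where g = "\<lambda>y. inv\<^bsub>H\<^esub> \<one> \<otimes>\<^bsub>H\<^esub> y"])
        (use H(2) H.inv_closed H.m_closed in \<open>auto simp: \<theta>_def simp flip: H.m_assoc\<close>)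
    ultimately show ?thesis by (auto intro!: is_isoI simp: iso_def)
  qed
  with metric translation show ?thesis
    by (auto simp: natural_group_def isometric_right_translations_def is_group)
qed

section \<open>Cardinality of second countable Hausdorff spaces\<close>

text \<open>A point is determined by the set of the countably many basic open sets that contain it.\<close>

lemma second_countable_Hausdorff_lepoll_reals:
  assumes "second_countable X" "Hausdorff_space X"
  shows "topspace X \<lesssim> (UNIV :: real set)"
proof -
  obtain \<B> where \<B>: "countable \<B>" "\<And>V. V \<in> \<B> \<Longrightarrow> openin X V"
      "\<And>U x. \<lbrakk>openin X U; x \<in> U\<rbrakk> \<Longrightarrow> \<exists>V\<in>\<B>. x \<in> V \<and> V \<subseteq> U"
    using assms(1) unfolding second_countable_def by meson
  define code where "code x = to_nat_on \<B> ` {V \<in> \<B>. x \<in> V}" for x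
  have "inj_on code (topspace X)"
  proof (rule inj_onI, rule ccontr)
    fix x y assume xy: "x \<in> topspace X" "y \<in> topspace X" "code x = code y" "x \<noteq> y"
    then obtain U V where UV: "openin X U" "openin X V" "x \<in> U" "y \<in> V" "disjnt U V"
      using assms(2) unfolding Hausdorff_space_def by meson
    then obtain W where W: "W \<in> \<B>" "x \<in> W" "W \<subseteq> U" using \<B>(3) by blast
    then have "to_nat_on \<B> W \<in> code y" using xy(3) by (auto simp: code_def)
    then have "y \<in> W"
      using inj_onD[OF inj_on_to_nat_on[OF \<B>(1)]] W(1) by (auto simp: code_def)
    then show False using W UV by (auto simp: disjnt_iff)
  qed
  then have "topspace X \<lesssim> (UNIV :: nat set set)" by (auto simp: lepoll_def)
  then show ?thesis using nat_sets_eqpoll_reals lepoll_trans2 by blast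
qed

theorem theorem10:
  fixes G :: "('a, 'b) monoid_scheme" and n :: nat and X :: "'a topology" and \<A> :: "'a chart set"
  assumes "lie_group G n X \<A>"
    and "second_countable X"
    and "\<not> metabelian G"
  shows "natural_group G"
proof -
  have "group G" "topspace X = carrier G" "Hausdorff_space X"
    using assms(1) by (auto simp: lie_group_def smooth_manifold_def)
  then show ?thesis
    using group.nonmetabelian_imp_natural second_countable_Hausdorff_lepoll_reals assms(2,3) by metis
qed

end
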